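(* For testing the simple hypothesis $H_0:\theta=\theta_0$ against the simple alternative $H_1:\theta=\theta_1$, the region $W_0=\{\underline{x}\in S : L_1(\underline{x})\ge L_0(\underline{x})\}$ is optimum; that is, $$\int_{W_0} L_1\,dx-\int_{W_0} L_0\,dx\;\ge\;\int_{W} L_1\,dx-\int_{W} L_0\,dx$$ for every other critical region $W\subseteq S$.
   Context: Let $X$ be a random variable with probability distribution $P(x/\theta)$, $\theta\in\Theta$, where $\Theta=\{\theta_0,\theta_1\}$. Let $S$ be the sample space of outcomes $\underline{x}=(x_1,\dots,x_n)$ of an experiment. $L_0=L(\underline{x}/\theta_0)$ and $L_1=L(\underline{x}/\theta_1)$ are the likelihood functions (joint probability densities on $S$ with respect to $dx$) under $H_0$ and $H_1$ respectively. A critical region is a (measurable) region $W\subseteq S$ such that $H_0$ is rejected when the observed $\underline{x}$ lies in $W$. A critical region $W_0$ is called optimum if $\int_{W_0} L_1\,dx-\int_{W_0} L_0\,dx\ge\int_{W} L_1\,dx-\int_{W} L_0\,dx$ for every other critical region $W$ (equivalently, it maximizes power minus size). *)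

theory Defs
  imports "HOL-Probability.Probability"
begin

text \<open>
  \<open>f\<close> is the joint probability density on \<open>S\<close>, with respect to Lebesgue measure, of the sample
  vector \<open>X = (X\<^sub>1, \<dots>, X\<^sub>n)\<close> under the law \<open>M\<close>; the components need not be independent. Since
  \<^const>\<open>distributed\<close> takes an \<open>ennreal\<close>-valued density and \<^const>\<open>ennreal\<close> truncates negative
  numbers, nonnegativity is required separately. Nothing is assumed about \<open>f\<close> outside \<open>S\<close>.
\<close>

definition likelihood_on ::
  "(real ^ 'n::finite) set \<Rightarrow> 'w measure \<Rightarrow> ('w \<Rightarrow> real ^ 'n) \<Rightarrow> (real ^ 'n \<Rightarrow> real) \<Rightarrow> bool" where
  "likelihood_on S M X f \<longleftrightarrow>
     prob_space M \<and> (\<forall>x\<in>S. 0 \<le> f x) \<and>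
     distributed M (restrict_space lborel S) X (\<lambda>x. ennreal (f x))"

definition critical_region :: "(real ^ 'n::finite) set \<Rightarrow> (real ^ 'n) set \<Rightarrow> bool" where
  "critical_region S W \<longleftrightarrow> W \<subseteq> S \<and> W \<in> sets borel"

definition optimum_critical_region ::
  "(real ^ 'n::finite) set \<Rightarrow> (real ^ 'n \<Rightarrow> real) \<Rightarrow> (real ^ 'n \<Rightarrow> real) \<Rightarrow> (real ^ 'n) set \<Rightarrow> bool" where
  "optimum_critical_region S L0 L1 W0 \<longleftrightarrow>
     critical_region S W0 \<and>
     (\<forall>W. critical_region S W \<longrightarrow>
        (LINT x:W0|lborel. L1 x) - (LINT x:W0|lborel. L0 x)
          \<ge> (LINT x:W|lborel. L1 x) - (LINT x:W|lborel. L0 x))"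

end

theory Submission imports Defs begin

text \<open>Power minus size of a region \<open>W\<close> is the integral over \<open>W\<close> of
  the single function g = L1 - L0. The region \<open>W0\<close> collects exactly the points of
  \<open>S\<close> where g is nonnegative, so any other \<open>W\<close> either omits nonnegative
  contributions or adds negative ones; this is \<open>set_integral_le_nonneg_region\<close>. Merging
  the two integrals into one requires both likelihoods to be integrable on \<open>S\<close>, which
  \<open>likelihood_on_set_integrable\<close> obtains from their being probability
  densities.\<close>

text \<open>The density hypothesis only gives measurability of \<open>ennreal (f x)\<close>;
  nonnegativity on \<open>S\<close> lets \<open>enn2real\<close> recover \<open>f\<close> itself
  there.\<close>

lemma likelihood_on_measurable:
  assumes "likelihood_on S M X f"
  shows "f \<in> borel_measurable (restrict_space lborel S)"
proof -
  have "(\<lambda>x. ennreal (f x)) \<in> borel_measurable (restrict_space lborel S)"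
    using assms distributed_borel_measurable unfolding likelihood_on_def by blast
  then have "(\<lambda>x. enn2real (ennreal (f x))) \<in> borel_measurable (restrict_space lborel S)"
    by measurable
  moreover have "enn2real (ennreal (f x)) = f x" if "x \<in> space (restrict_space lborel S)" for x
    using assms that by (auto simp: likelihood_on_def space_restrict_space)
  ultimately show ?thesis
    by (simp cong: measurable_cong)
qed

text \<open>The density has the total mass of the law of \<open>X\<close> as its integral over
  \<open>S\<close>, namely 1. For a nonnegative measurable function, this finiteness is
  integrability.\<close>

lemma likelihood_on_set_integrable:
  assumes "S \<in> sets borel" and lik: "likelihood_on S M X f"
  shows "set_integrable lborel S f"
proof -
  let ?N = "restrict_space lborel S"
  have P: "prob_space M" and D: "distributed M ?N X (\<lambda>x. ennreal (f x))"
    using lik unfolding likelihood_on_def by auto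
  have X: "X \<in> measurable M ?N"
    using D by (simp add: distributed_def)
  have "(\<integral>\<^sup>+ x. ennreal (f x) \<partial>?N) = emeasure (density ?N (\<lambda>x. ennreal (f x))) (space ?N)"
    using distributed_borel_measurable[OF D]
    by (subst emeasure_density) (auto intro!: nn_integral_cong)
  also have "\<dots> = emeasure (distr M ?N X) (space ?N)"
    using D by (simp add: distributed_def)
  also have "\<dots> = 1"
    using prob_space.emeasure_space_1[OF prob_space.prob_space_distr[OF P X]] by simp
  finally have "integrable ?N f"
    using lik likelihood_on_measurable[OF lik]
    by (intro integrableI_nonneg AE_I2) (auto simp: likelihood_on_def space_restrict_space)
  \<comment> \<open>Since \<open>S\<close> is Borel, integrating over the restricted space amounts
    to integrating against the indicator of \<open>S\<close> on \<open>lborel\<close>.\<close>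
  then show ?thesis
    using assms(1) by (simp add: integrable_restrict_space set_integrable_def)
qed

text \<open>The integrands, multiplied by their indicators, already compare pointwise: where
  \<open>g\<close> is negative the right one is 0 and the left one is at most 0; elsewhere in
  \<open>S\<close> the right one is \<open>g\<close> and the left one is \<open>g\<close> or
  0.\<close>

lemma set_integral_le_nonneg_region:
  fixes g :: "'a \<Rightarrow> real"
  assumes int: "set_integrable N S g"
    and W: "W \<in> sets N" "W \<subseteq> S" and P: "{x \<in> S. 0 \<le> g x} \<in> sets N"
  shows "(LINT x:W|N. g x) \<le> (LINT x:{x \<in> S. 0 \<le> g x}|N. g x)"
  unfolding set_lebesgue_integral_def
proof (rule integral_mono)
  show "integrable N (\<lambda>x. indicator W x *\<^sub>R g x)"
    using set_integrable_subset[OF int W] by (simp add: set_integrable_def)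
  show "integrable N (\<lambda>x. indicator {x \<in> S. 0 \<le> g x} x *\<^sub>R g x)"
    using set_integrable_subset[OF int P] by (auto simp: set_integrable_def)
qed (use W in \<open>auto simp: indicator_def\<close>)

theorem lemma1:
  fixes S :: "(real ^ 'n::finite) set"
    and \<Theta> :: "'p set" and \<theta>0 \<theta>1 :: 'p
    and M :: "'p \<Rightarrow> 'w measure" and X :: "'w \<Rightarrow> real ^ 'n"
    and L :: "'p \<Rightarrow> real ^ 'n \<Rightarrow> real"
  assumes "\<Theta> = {\<theta>0, \<theta>1}"
    and "S \<in> sets borel"
    and "\<And>\<theta>. \<theta> \<in> \<Theta> \<Longrightarrow> likelihood_on S (M \<theta>) X (L \<theta>)"
  shows "optimum_critical_region S (L \<theta>0) (L \<theta>1) {x \<in> S. L \<theta>1 x \<ge> L \<theta>0 x}"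
proof -
  let ?W0 = "{x \<in> S. L \<theta>1 x \<ge> L \<theta>0 x}"
  let ?g = "\<lambda>x. L \<theta>1 x - L \<theta>0 x"
  have lik: "likelihood_on S (M \<theta>0) X (L \<theta>0)" "likelihood_on S (M \<theta>1) X (L \<theta>1)"
    using assms by auto
  note int = lik[THEN likelihood_on_set_integrable[OF assms(2)]]
  note [measurable] = lik[THEN likelihood_on_measurable]
  \<comment> \<open>The likelihoods are known to be measurable only on \<open>S\<close>, so the
    argument stays in the trace sigma-algebra; \<open>S\<close> being Borel then makes its members
    Borel.\<close>
  have "{x \<in> space (restrict_space lborel S). L \<theta>1 x \<ge> L \<theta>0 x} \<in> sets (restrict_space lborel S)"
    by measurable
  then have W0: "?W0 \<in> sets borel"
    using assms(2) by (simp add: space_restrict_space sets_restrict_space_iff)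
  \<comment> \<open>Both likelihoods inherit integrability on \<open>W\<close> from
    \<open>S\<close>, so linearity applies.\<close>
  have diff: "(LINT x:W|lborel. L \<theta>1 x) - (LINT x:W|lborel. L \<theta>0 x) = (LINT x:W|lborel. ?g x)"
    if "W \<in> sets borel" "W \<subseteq> S" for W
    using that int[THEN set_integrable_subset, of W]
    by (intro set_integral_diff(2)[symmetric]) auto
  have g: "set_integrable lborel S ?g"
    using int by (intro set_integral_diff(1))
  have "(LINT x:W|lborel. ?g x) \<le> (LINT x:?W0|lborel. ?g x)" if "W \<in> sets borel" "W \<subseteq> S" for W
    using set_integral_le_nonneg_region[OF g, of W] that W0 by simp
  then show ?thesis
    using W0 diff[of ?W0] diff
    by (auto simp: optimum_critical_region_def critical_region_def)
qed

end
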